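(* Let $A \in \mathbb{R}^{n\times n}$, $B = [B_1 \ \cdots \ B_m] \in \mathbb{R}^{n\times m}$ (with columns $B_i$), $F \in \mathbb{R}_+^{n\times l}$, $E = [E_1^\top \ \cdots \ E_m^\top]^\top \in \mathbb{R}_+^{m\times n}$ (with rows $E_i$), $s \in \mathbb{R}^n$ with $s>0$, $r \in \mathbb{R}^m$ and $\gamma \in \mathbb{R}_+^l$. Suppose that $$A \geq |B|E, \qquad s > E^\top |r| .$$ For $x_0\in\mathbb{R}_+^n$ consider the minimax optimal control problem $$\inf_{\mu}\ \max_{w}\ \sum_{t=0}^{\infty}\left[s^\top x(t) + r^\top u(t) - \gamma^\top w(t)\right]$$ subject to $x(t+1) = Ax(t)+Bu(t)+Fw(t)$, $u(t)=\mu(x(t))$, $x(0)=x_0$, $|u(t)|\le Ex(t)$, $w(t)\ge 0$ for all $t\ge 0$. Consider also the linear program $$\text{maximize } \mathbf{1}^\top p \ \text{ over } p\in\mathbb{R}_+^n,\ \zeta\in\mathbb{R}_+^m \quad \text{subject to}\quad p \le s + A^\top p - E^\top \zeta,\qquad -\zeta \le r + B^\top p \le \zeta .$$ Then the optimal control problem has a finite value for every $x_0\in\mathbb{R}_+^n$ if and only if the linear program has an optimal solution $(p,\zeta)$ with $$\gamma \ge F^\top p .$$ If this is true, then for every $x_0\in\mathbb{R}_+^n$ the optimal control problem has the minimum value $p^\top x_0$, where $p$ is the one obtained from the linear program and satisfies $$p \le s + A^\top p - E^\top \left| r + B^\top p\right| .$$ Moreover, the control law $u(t) = -Kx(t)$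 is optimal, where $$K := \begin{bmatrix} \mathrm{sign}(r_1 + p^\top B_1)E_1\\ \vdots\\ \mathrm{sign}(r_m + p^\top B_m)E_m\end{bmatrix}\in\mathbb{R}^{m\times n}.$$
   Context: $\mathbb{R}_+$ is the set of nonnegative reals. For matrices or vectors of equal size, $X\ge Y$ (resp. $X>Y$) means every entry of $X-Y$ is nonnegative (resp. positive); $|X|$ is the entrywise absolute value; $\mathbf{1}$ is the all-ones column vector. The state $x(t)$ is $n$-dimensional, the control $u(t)$ is $m$-dimensional and the disturbance $w(t)$ is $l$-dimensional. In the optimal control problem, the infimum is over all (possibly nonlinear) state-feedback policies $\mu:\mathbb{R}_+^n\to\mathbb{R}^m$ respecting $|\mu(x)|\le Ex$. The inner "max" is the supremum (possibly $+\infty$) over all disturbance sequences $(w(t))_{t\ge0}$ with $w(t)\in\mathbb{R}_+^l$; the disturbance is otherwise unconstrained. The infinite sum is read as the limit superior of its partial sums, with values in the extended reals. The value of the problem is the resulting element of the extended reals, and it is finite if it is a real number. A policy is optimal if, for every $x_0\in\mathbb{R}_+^n$, its worst-case cost (the inner supremum) equals the value. The sign function is $\mathrm{sign}(a)=1$ for $a>0$, $-1$ for $a<0$, and $0$ for $a=0$. *)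

theory Defs
  imports "HOL-Analysis.Analysis"
begin

text \<open>
  On \<^typ>\<open>real^'n\<close> and \<^typ>\<open>real^'n^'m\<close> the library's \<open>\<le>\<close> and \<open>\<bar>_\<bar>\<close> are entrywise.
  Its \<open><\<close> is not the entrywise strict order (it is \<open>x \<le> y \<and> \<not> y \<le> x\<close>), so it is avoided.
\<close>

definition vec_less :: "real^'n \<Rightarrow> real^'n \<Rightarrow> bool"
  where "vec_less x y \<longleftrightarrow> (\<forall>i. x $ i < y $ i)"

text \<open>
  A policy is a map from the nonnegative orthant; it is represented by a total function whose
  values outside the orthant are irrelevant.
\<close>

definition admissible :: "real^'n^'m \<Rightarrow> (real^'n \<Rightarrow> real^'m) \<Rightarrow> bool"
  where "admissible E \<mu> \<longleftrightarrow> (\<forall>x\<ge>0. \<bar>\<mu> x\<bar> \<le> E *v x)"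

primrec state ::
  "real^'n^'n \<Rightarrow> real^'m^'n \<Rightarrow> real^'l^'n \<Rightarrow> (real^'n \<Rightarrow> real^'m) \<Rightarrow> real^'n \<Rightarrow> (nat \<Rightarrow> real^'l)
    \<Rightarrow> nat \<Rightarrow> real^'n"
where
  "state A B F \<mu> x0 w 0 = x0"
| "state A B F \<mu> x0 w (Suc t) =
     A *v state A B F \<mu> x0 w t + B *v \<mu> (state A B F \<mu> x0 w t) + F *v w t"

definition stage_cost ::
  "real^'n \<Rightarrow> real^'m \<Rightarrow> real^'l \<Rightarrow> real^'n \<Rightarrow> real^'m \<Rightarrow> real^'l \<Rightarrow> real"
  where "stage_cost s r \<gamma> x u w = s \<bullet> x + r \<bullet> u - \<gamma> \<bullet> w"

definition total_cost ::
  "real^'n^'n \<Rightarrow> real^'m^'n \<Rightarrow> real^'l^'n \<Rightarrow> real^'n \<Rightarrow> real^'m \<Rightarrow> real^'l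
    \<Rightarrow> (real^'n \<Rightarrow> real^'m) \<Rightarrow> real^'n \<Rightarrow> (nat \<Rightarrow> real^'l) \<Rightarrow> ereal"
where
  "total_cost A B F s r \<gamma> \<mu> x0 w =
     limsup (\<lambda>T. ereal (\<Sum>t<T.
       stage_cost s r \<gamma> (state A B F \<mu> x0 w t) (\<mu> (state A B F \<mu> x0 w t)) (w t)))"

definition worst_case_cost ::
  "real^'n^'n \<Rightarrow> real^'m^'n \<Rightarrow> real^'l^'n \<Rightarrow> real^'n \<Rightarrow> real^'m \<Rightarrow> real^'l
    \<Rightarrow> (real^'n \<Rightarrow> real^'m) \<Rightarrow> real^'n \<Rightarrow> ereal"
where
  "worst_case_cost A B F s r \<gamma> \<mu> x0 =
     (SUP w \<in> {w. \<forall>t. 0 \<le> w t}. total_cost A B F s r \<gamma> \<mu> x0 w)"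

definition opt_value ::
  "real^'n^'n \<Rightarrow> real^'m^'n \<Rightarrow> real^'l^'n \<Rightarrow> real^'n^'m \<Rightarrow> real^'n \<Rightarrow> real^'m \<Rightarrow> real^'l
    \<Rightarrow> real^'n \<Rightarrow> ereal"
where
  "opt_value A B F E s r \<gamma> x0 =
     (INF \<mu> \<in> {\<mu>. admissible E \<mu>}. worst_case_cost A B F s r \<gamma> \<mu> x0)"

definition optimal_policy ::
  "real^'n^'n \<Rightarrow> real^'m^'n \<Rightarrow> real^'l^'n \<Rightarrow> real^'n^'m \<Rightarrow> real^'n \<Rightarrow> real^'m \<Rightarrow> real^'l
    \<Rightarrow> (real^'n \<Rightarrow> real^'m) \<Rightarrow> bool"
where
  "optimal_policy A B F E s r \<gamma> \<mu> \<longleftrightarrow>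
     admissible E \<mu> \<and>
     (\<forall>x0\<ge>0. worst_case_cost A B F s r \<gamma> \<mu> x0 = opt_value A B F E s r \<gamma> x0)"

definition lp_feasible ::
  "real^'n^'n \<Rightarrow> real^'m^'n \<Rightarrow> real^'n^'m \<Rightarrow> real^'n \<Rightarrow> real^'m \<Rightarrow> real^'n \<Rightarrow> real^'m \<Rightarrow> bool"
where
  "lp_feasible A B E s r p \<zeta> \<longleftrightarrow>
     0 \<le> p \<and> 0 \<le> \<zeta> \<and>
     p \<le> s + transpose A *v p - transpose E *v \<zeta> \<and>
     - \<zeta> \<le> r + transpose B *v p \<and> r + transpose B *v p \<le> \<zeta>"

definition lp_optimal ::
  "real^'n^'n \<Rightarrow> real^'m^'n \<Rightarrow> real^'n^'m \<Rightarrow> real^'n \<Rightarrow> real^'m \<Rightarrow> real^'n \<Rightarrow> real^'m \<Rightarrow> bool"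
where
  "lp_optimal A B E s r p \<zeta> \<longleftrightarrow>
     lp_feasible A B E s r p \<zeta> \<and>
     (\<forall>p' \<zeta>'. lp_feasible A B E s r p' \<zeta>' \<longrightarrow> 1 \<bullet> p' \<le> 1 \<bullet> p)"

definition gain :: "real^'m^'n \<Rightarrow> real^'n^'m \<Rightarrow> real^'m \<Rightarrow> real^'n \<Rightarrow> real^'n^'m"
  where "gain B E r p = (\<chi> i. sgn (r $ i + p \<bullet> column i B) *\<^sub>R row i E)"

end

theory Submission
  imports Defs
begin

text \<open>
  Put \<open>g p = s + A\<^sup>T p - E\<^sup>T \<bar>r + B\<^sup>T p\<bar>\<close>. For \<open>x \<ge> 0\<close> the number \<open>g p \<bullet> x\<close> is the minimum of
  \<open>s \<bullet> x + r \<bullet> u + p \<bullet> (A x + B u)\<close> over \<open>\<bar>u\<bar> \<le> E x\<close>, and it is attained at \<open>u = - K x\<close>. Since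
  \<open>A x + B u \<ge> 0\<close> for all these \<open>u\<close>, the map \<open>g\<close> is monotone and concave, and \<open>g 0 > 0\<close>.
  Concavity and \<open>g 0 > 0\<close> make every nonnegative fixed point of \<open>g\<close> dominate all nonnegative \<open>q\<close>
  with \<open>q \<le> g q\<close>; so the optimum of the linear program is the unique fixed point of \<open>g\<close>, and it is
  also the limit of the value iteration \<open>g\<^sup>k 0\<close>. The cost of any policy over \<open>k\<close> steps with zero
  disturbance is at least \<open>g\<^sup>k 0 \<bullet> x0\<close>; with an initial impulse \<open>v\<close> its limit is at least
  \<open>p \<bullet> x0 + (F\<^sup>T p - \<gamma>) \<bullet> v\<close>, which forces \<open>F\<^sup>T p \<le> \<gamma>\<close> if the value is finite. Conversely,
  under \<open>F\<^sup>T p \<le> \<gamma>\<close> the cost of \<open>u = - K x\<close> telescopes to at most \<open>p \<bullet> x0\<close>.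
\<close>

section \<open>Entrywise order, inner products and limits of vectors\<close>

lemma inner_mono_left:
  fixes p q x :: "real^'n"
  assumes "p \<le> q" "0 \<le> x"
  shows "p \<bullet> x \<le> q \<bullet> x"
  using assms by (auto simp: less_eq_vec_def inner_vec_def intro!: sum_mono mult_right_mono)

lemma vec_le_if_inner_le:
  fixes p q :: "real^'n"
  assumes "\<And>x. 0 \<le> x \<Longrightarrow> p \<bullet> x \<le> q \<bullet> x"
  shows "p \<le> q"
  unfolding less_eq_vec_def
proof
  fix i
  have "(0::real^'n) \<le> axis i 1"
    by (simp add: less_eq_vec_def axis_def)
  from assms[OF this] show "p $ i \<le> q $ i"
    by (simp add: inner_axis)
qed

lemma inner_transpose_mult:
  fixes M :: "real^'n^'m"
  shows "(transpose M *v p) \<bullet> x = p \<bullet> (M *v x)"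
  by (simp add: dot_lmul_matrix)

lemma mult_vec_nonneg:
  fixes M :: "real^'n^'m"
  assumes "0 \<le> M" "0 \<le> x"
  shows "0 \<le> M *v x"
  using assms by (auto simp: less_eq_vec_def matrix_vector_mult_def intro!: sum_nonneg)

lemma neg_inner_le_abs_inner:
  fixes q u y :: "real^'m"
  assumes "\<bar>u\<bar> \<le> y"
  shows "- (q \<bullet> u) \<le> \<bar>q\<bar> \<bullet> y"
  unfolding inner_vec_def sum_negf[symmetric]
proof (rule sum_mono)
  fix i
  have "- (q $ i * u $ i) \<le> \<bar>q $ i\<bar> * \<bar>u $ i\<bar>"
    by (metis abs_ge_minus_self abs_mult)
  also have "\<dots> \<le> \<bar>q $ i\<bar> * y $ i"
    using assms by (intro mult_left_mono) (auto simp: less_eq_vec_def abs_vec_def)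
  finally show "- (q $ i \<bullet> u $ i) \<le> \<bar>q\<bar> $ i \<bullet> y $ i"
    by (simp add: abs_vec_def)
qed

lemma tendsto_abs_vec [tendsto_intros]:
  fixes f :: "'a \<Rightarrow> real^'n"
  assumes "(f \<longlongrightarrow> l) G"
  shows "((\<lambda>x. \<bar>f x\<bar>) \<longlongrightarrow> \<bar>l\<bar>) G"
  unfolding abs_vec_def by (intro tendsto_intros assms)

lemma tendsto_mult_vec [tendsto_intros]:
  fixes M :: "real^'n^'m"
  assumes "(f \<longlongrightarrow> l) G"
  shows "((\<lambda>x. M *v f x) \<longlongrightarrow> M *v l) G"
  using assms by (rule bounded_linear.tendsto[OF matrix_vector_mul_bounded_linear])

text \<open>For nonnegative vectors a bound on the sum of the entries bounds each entry, so scalar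
  monotone convergence applies entry by entry.\<close>

lemma incseq_vec_convergent:
  fixes X :: "nat \<Rightarrow> real^'n"
  assumes mono: "incseq X" and bnd: "\<And>T. 1 \<bullet> X T \<le> c" and nonneg: "\<And>T. 0 \<le> X T"
  obtains p where "X \<longlonglongrightarrow> p" "\<And>T. X T \<le> p"
proof -
  have inc: "incseq (\<lambda>T. X T $ i)" for i
    using mono by (auto simp: incseq_def less_eq_vec_def)
  have le: "X T $ i \<le> c" for T i
  proof -
    have "X T $ i \<le> (\<Sum>i\<in>UNIV. X T $ i)"
      using nonneg[of T] by (intro member_le_sum) (auto simp: less_eq_vec_def)
    with bnd[of T] show ?thesis
      by (simp add: inner_vec_def)
  qed
  have "\<exists>L. (\<lambda>T. X T $ i) \<longlonglongrightarrow> L \<and> (\<forall>T. X T $ i \<le> L)" for i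
    using incseq_convergent[OF inc, of i c] le by metis
  then obtain L where L: "\<And>i. (\<lambda>T. X T $ i) \<longlonglongrightarrow> L i" "\<And>i T. X T $ i \<le> L i"
    by metis
  show thesis
  proof
    show "X \<longlonglongrightarrow> (\<chi> i. L i)"
      by (rule vec_tendstoI) (simp add: L)
    show "X T \<le> (\<chi> i. L i)" for T
      by (simp add: less_eq_vec_def L)
  qed
qed

text \<open>\<open>state\<close> unrolls from the last step, whereas the induction on the horizon in
  \<open>cost_sum_ge\<close> peels off the first one.\<close>

lemma state_shift:
  "state A B F \<mu> x0 w (Suc t) =
     state A B F \<mu> (A *v x0 + B *v \<mu> x0 + F *v w 0) (\<lambda>t. w (Suc t)) t"
  by (induction t) simp_all

section \<open>The Bellman operator: minimization over controls, monotonicity, concavity\<close>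

locale positive_control =
  fixes A :: "real^'n^'n" and B :: "real^'m^'n" and F :: "real^'l^'n" and E :: "real^'n^'m"
    and s :: "real^'n" and r :: "real^'m" and \<gamma> :: "real^'l"
  assumes F_nonneg: "0 \<le> F" and E_nonneg: "0 \<le> E"
    and BE_le_A: "\<bar>B\<bar> ** E \<le> A"
    and s_gt: "vec_less (transpose E *v \<bar>r\<bar>) s"
begin

definition bellman :: "real^'n \<Rightarrow> real^'n"
  where "bellman p = s + transpose A *v p - transpose E *v \<bar>r + transpose B *v p\<bar>"

abbreviation value_iter :: "nat \<Rightarrow> real^'n"
  where "value_iter T \<equiv> (bellman ^^ T) 0"

text \<open>Each entry of \<open>B *v u\<close> is at least the negative of that entry of
  \<open>(\<bar>B\<bar> ** E) *v x\<close>, which \<open>A *v x\<close> dominates. This is where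
  \<open>BE_le_A\<close> enters; it keeps states in the orthant and makes \<open>bellman\<close>
  monotone.\<close>

lemma next_state_nonneg:
  assumes "0 \<le> x" "\<bar>u\<bar> \<le> E *v x"
  shows "0 \<le> A *v x + B *v u"
  unfolding less_eq_vec_def
proof
  fix i
  have "- (row i B \<bullet> u) \<le> \<bar>row i B\<bar> \<bullet> (E *v x)"
    using assms(2) by (rule neg_inner_le_abs_inner)
  also have "\<dots> = ((\<bar>B\<bar> ** E) *v x) $ i"
    by (simp add: matrix_vector_mul_assoc[symmetric] matrix_vector_mul_component
        inner_vec_def row_def abs_vec_def)
  also have "\<dots> \<le> (A *v x) $ i"
    using BE_le_A assms(1) unfolding matrix_vector_mult_def
    by (auto simp: less_eq_vec_def intro!: sum_mono mult_right_mono)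
  also have "row i B \<bullet> u = (B *v u) $ i"
    by (simp add: matrix_vector_mult_def inner_vec_def row_def)
  finally show "(0::real^'n) $ i \<le> (A *v x + B *v u) $ i"
    by simp
qed

lemma bellman_inner:
  "bellman p \<bullet> x = s \<bullet> x + p \<bullet> (A *v x) - \<bar>r + transpose B *v p\<bar> \<bullet> (E *v x)"
  unfolding bellman_def inner_add_left inner_diff_left inner_transpose_mult ..

text \<open>The terms in \<open>u\<close> collect to
  \<open>(r + transpose B *v p) \<bullet> u\<close>, which on the box of admissible controls is at
  least \<open>- (\<bar>r + transpose B *v p\<bar> \<bullet> (E *v x))\<close>. By
  \<open>bellman_eq\<close> the gain attains this bound.\<close>

lemma bellman_le:
  assumes "\<bar>u\<bar> \<le> E *v x"
  shows "bellman p \<bullet> x \<le> s \<bullet> x + r \<bullet> u + p \<bullet> (A *v x + B *v u)"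
  using neg_inner_le_abs_inner[OF assms, of "r + transpose B *v p"]
  unfolding bellman_inner inner_add_left inner_add_right inner_transpose_mult by linarith

lemma gain_nth:
  "(gain B E r p *v x) $ i = sgn ((r + transpose B *v p) $ i) * (E *v x) $ i"
proof -
  have "(transpose B *v p) $ i = p \<bullet> column i B"
    by (simp add: vector_matrix_mult_def inner_vec_def column_def mult.commute)
  then show ?thesis
    by (simp add: gain_def matrix_vector_mult_def row_def sum_distrib_left mult.assoc)
qed

lemma gain_admissible:
  assumes "0 \<le> x"
  shows "\<bar>- (gain B E r p *v x)\<bar> \<le> E *v x"
  unfolding less_eq_vec_def
proof
  fix i
  have "0 \<le> (E *v x) $ i"
    using mult_vec_nonneg[OF E_nonneg assms] by (simp add: less_eq_vec_def)
  then show "\<bar>- (gain B E r p *v x)\<bar> $ i \<le> (E *v x) $ i"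
    by (simp add: abs_vec_def gain_nth abs_mult abs_sgn_eq)
qed

lemma bellman_eq:
  assumes "u = - (gain B E r p *v x)"
  shows "bellman p \<bullet> x = s \<bullet> x + r \<bullet> u + p \<bullet> (A *v x + B *v u)"
proof -
  have "\<bar>r + transpose B *v p\<bar> \<bullet> (E *v x) = (r + transpose B *v p) \<bullet> (gain B E r p *v x)"
    unfolding inner_vec_def gain_nth by (intro sum.cong) (auto simp: abs_vec_def abs_sgn)
  then have "\<bar>r + transpose B *v p\<bar> \<bullet> (E *v x) = - ((r + transpose B *v p) \<bullet> u)"
    unfolding assms inner_minus_right minus_minus .
  then show ?thesis
    unfolding bellman_inner inner_add_left inner_add_right inner_transpose_mult by linarith
qed

lemma bellman_mono:
  assumes "p \<le> q"
  shows "bellman p \<le> bellman q"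
proof (rule vec_le_if_inner_le)
  fix x :: "real^'n" assume x: "0 \<le> x"
  \<comment> \<open>The minimizer for the larger vector \<open>q\<close> is merely a competitor for
    \<open>p\<close>.\<close>
  define u where "u = - (gain B E r q *v x)"
  have u: "\<bar>u\<bar> \<le> E *v x"
    using gain_admissible[OF x] by (simp add: u_def)
  have "bellman p \<bullet> x \<le> s \<bullet> x + r \<bullet> u + p \<bullet> (A *v x + B *v u)"
    by (rule bellman_le[OF u])
  also have "\<dots> \<le> s \<bullet> x + r \<bullet> u + q \<bullet> (A *v x + B *v u)"
    using inner_mono_left[OF assms next_state_nonneg[OF x u]] by linarith
  also have "\<dots> = bellman q \<bullet> x"
    using bellman_eq[OF u_def] by simp
  finally show "bellman p \<bullet> x \<le> bellman q \<bullet> x" .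
qed

text \<open>For \<open>x \<ge> 0\<close>, \<open>bellman p \<bullet> x\<close> is a minimum of
  functions affine in \<open>p\<close>. The control that is optimal for
  \<open>\<theta> *\<^sub>R p\<close> serves as a competitor for both \<open>p\<close> and
  \<open>0\<close>.\<close>

lemma bellman_concave:
  assumes "0 \<le> \<theta>" "\<theta> \<le> 1"
  shows "\<theta> *\<^sub>R bellman p + (1 - \<theta>) *\<^sub>R bellman 0 \<le> bellman (\<theta> *\<^sub>R p)"
proof (rule vec_le_if_inner_le)
  fix x :: "real^'n" assume x: "0 \<le> x"
  define u where "u = - (gain B E r (\<theta> *\<^sub>R p) *v x)"
  define c y where "c = s \<bullet> x + r \<bullet> u" and "y = A *v x + B *v u"
  have u: "\<bar>u\<bar> \<le> E *v x"
    using gain_admissible[OF x] by (simp add: u_def)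
  have "\<theta> * (bellman p \<bullet> x) + (1 - \<theta>) * (bellman 0 \<bullet> x) \<le> \<theta> * (c + p \<bullet> y) + (1 - \<theta>) * (c + 0 \<bullet> y)"
    unfolding c_def y_def using assms by (intro add_mono mult_left_mono bellman_le[OF u]) auto
  also have "\<dots> = c + (\<theta> *\<^sub>R p) \<bullet> y"
    by (simp add: algebra_simps)
  also have "\<dots> = bellman (\<theta> *\<^sub>R p) \<bullet> x"
    using bellman_eq[OF u_def] by (simp add: c_def y_def)
  finally show "(\<theta> *\<^sub>R bellman p + (1 - \<theta>) *\<^sub>R bellman 0) \<bullet> x \<le> bellman (\<theta> *\<^sub>R p) \<bullet> x"
    by (simp add: inner_add_left)
qed

section \<open>Fixed points and convergence of value iteration\<close>

lemma bellman_0_pos: "0 < bellman 0 $ i"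
  using s_gt by (simp add: bellman_def vec_less_def)

lemma bellman_nonneg:
  assumes "0 \<le> p"
  shows "0 \<le> bellman p"
proof -
  have "0 \<le> bellman 0"
    using bellman_0_pos by (simp add: less_eq_vec_def less_imp_le)
  also have "\<dots> \<le> bellman p"
    by (rule bellman_mono[OF assms])
  finally show ?thesis .
qed

text \<open>If some entry of \<open>q\<close> exceeds that of \<open>p\<close>, shrink
  \<open>q\<close> until it lies below \<open>p\<close> and touches it at an entry \<open>i\<close>.
  Concavity and \<open>bellman 0 > 0\<close> lift the image of the shrunken vector strictly above
  \<open>p\<close> at \<open>i\<close>, while monotonicity keeps it below.\<close>

lemma fixed_point_greatest:
  assumes "0 \<le> p" "bellman p = p" "q \<le> bellman q"
  shows "q \<le> p"
proof (rule ccontr)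
  assume "\<not> q \<le> p"
  then obtain k where k: "p $ k < q $ k"
    by (auto simp: less_eq_vec_def not_le)
  \<comment> \<open>Strict positivity makes the ratios \<open>q $ j / p $ j\<close> meaningful; the
    largest one determines \<open>\<theta>\<close>.\<close>
  have pos: "0 < p $ j" for j
  proof -
    have "bellman 0 \<le> p"
      using bellman_mono[OF assms(1)] assms(2) by simp
    with bellman_0_pos[of j] show ?thesis
      by (auto simp: less_eq_vec_def intro: less_le_trans)
  qed
  define f where "f j = q $ j / p $ j" for j
  have "Max (range f) \<in> range f"
    by (intro Max_in) auto
  then obtain i where i: "f i = Max (range f)"
    by (metis rangeE)
  have le: "f j \<le> f i" for j
    unfolding i by (intro Max_ge) auto
  have "1 < f k"
    using k pos[of k] by (simp add: f_def)
  with le[of k] have gt1: "1 < f i"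
    by linarith
  define \<theta> where "\<theta> = 1 / f i"
  have \<theta>: "0 < \<theta>" "\<theta> < 1"
    using gt1 by (auto simp: \<theta>_def)
  have "\<theta> *\<^sub>R q \<le> p"
    unfolding less_eq_vec_def
  proof
    fix j
    have "q $ j \<le> f i * p $ j"
      using le[of j] pos[of j] by (simp add: f_def[of j] pos_divide_le_eq)
    then show "(\<theta> *\<^sub>R q) $ j \<le> p $ j"
      using gt1 by (simp add: \<theta>_def field_simps)
  qed
  then have "bellman (\<theta> *\<^sub>R q) \<le> p"
    using bellman_mono assms(2) by metis
  then have "bellman (\<theta> *\<^sub>R q) $ i \<le> p $ i"
    by (simp add: less_eq_vec_def)
  \<comment> \<open>At entry \<open>i\<close> the collected facts give the contradictory chain
    \<open>p = \<theta> q \<le> \<theta> bellman q < \<theta> bellman q + (1 - \<theta>) bellman 0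
    \<le> bellman (\<theta> q) \<le> p\<close>.\<close>
  moreover have "\<theta> * bellman q $ i + (1 - \<theta>) * bellman 0 $ i \<le> bellman (\<theta> *\<^sub>R q) $ i"
    using bellman_concave[of \<theta> q] \<theta> by (simp add: less_eq_vec_def)
  moreover have "\<theta> * q $ i \<le> \<theta> * bellman q $ i"
    using assms(3) \<theta> by (simp add: less_eq_vec_def)
  moreover have "0 < (1 - \<theta>) * bellman 0 $ i"
    using \<theta> bellman_0_pos[of i] by simp
  moreover have "\<theta> * q $ i = p $ i"
    using pos[of i] gt1 by (auto simp: \<theta>_def f_def field_simps)
  ultimately show False
    by linarith
qed

lemma value_iter_nonneg: "0 \<le> value_iter T"
  by (induction T) (simp_all add: bellman_nonneg)

lemma incseq_value_iter: "incseq value_iter"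
proof (rule incseq_SucI)
  show "value_iter T \<le> value_iter (Suc T)" for T
    by (induction T) (auto simp: bellman_nonneg intro: bellman_mono)
qed

lemma value_iter_le_fixed_point:
  assumes "0 \<le> p" "bellman p = p"
  shows "value_iter T \<le> p"
proof (induction T)
  case (Suc T)
  then show ?case
    using bellman_mono[of "value_iter T" p] assms(2) by simp
qed (simp add: assms)

lemma tendsto_bellman:
  assumes "(f \<longlongrightarrow> p) G"
  shows "((\<lambda>x. bellman (f x)) \<longlongrightarrow> bellman p) G"
  unfolding bellman_def by (intro tendsto_intros assms)

text \<open>The iterates increase, so the bound gives a limit, and continuity of
  \<open>bellman\<close> makes it a fixed point. A finite value at the all-ones initial state will
  later supply the bound.\<close>

lemma bounded_value_iter_tendsto:
  assumes "\<And>T. 1 \<bullet> value_iter T \<le> c"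
  obtains p where "value_iter \<longlonglongrightarrow> p" "0 \<le> p" "bellman p = p"
proof -
  obtain p where p: "value_iter \<longlonglongrightarrow> p" "\<And>T. value_iter T \<le> p"
    using incseq_vec_convergent[OF incseq_value_iter assms value_iter_nonneg] by blast
  have "(\<lambda>T. bellman (value_iter T)) \<longlonglongrightarrow> bellman p"
    by (rule tendsto_bellman[OF p(1)])
  moreover have "(\<lambda>T. bellman (value_iter T)) \<longlonglongrightarrow> p"
    using LIMSEQ_Suc[OF p(1)] by simp
  ultimately have "bellman p = p"
    by (rule LIMSEQ_unique)
  moreover have "0 \<le> p"
    using p(2)[of 0] by simp
  ultimately show thesis
    using p that by blast
qed

lemma value_iter_tendsto_fixed_point:
  assumes "0 \<le> p" "bellman p = p"
  shows "value_iter \<longlonglongrightarrow> p"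
proof -
  have "1 \<bullet> value_iter T \<le> 1 \<bullet> p" for T
    using inner_mono_left[OF value_iter_le_fixed_point[OF assms, of T], of 1]
    by (simp add: inner_commute less_eq_vec_def)
  then obtain q where q: "value_iter \<longlonglongrightarrow> q" "0 \<le> q" "bellman q = q"
    using bounded_value_iter_tendsto by blast
  \<comment> \<open>Each of two nonnegative fixed points dominates the other.\<close>
  have "q = p"
    using fixed_point_greatest[of p q] fixed_point_greatest[of q p] assms q by auto
  with q show ?thesis
    by simp
qed

section \<open>The linear program and fixed points of the Bellman operator\<close>

lemma lp_feasible_imp_le_bellman:
  assumes "lp_feasible A B E s r p \<zeta>"
  shows "p \<le> bellman p"
proof -
  have "\<bar>r + transpose B *v p\<bar> \<le> \<zeta>"
    unfolding less_eq_vec_def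
  proof
    fix i
    have "- (\<zeta> $ i) \<le> (r + transpose B *v p) $ i" "(r + transpose B *v p) $ i \<le> \<zeta> $ i"
      using assms by (simp_all add: lp_feasible_def less_eq_vec_def)
    then show "\<bar>r + transpose B *v p\<bar> $ i \<le> \<zeta> $ i"
      by (simp only: abs_vec_def vec_lambda_beta)
  qed
  then have "0 \<le> transpose E *v (\<zeta> - \<bar>r + transpose B *v p\<bar>)"
    using E_nonneg by (intro mult_vec_nonneg) (auto simp: less_eq_vec_def transpose_def)
  then have "transpose E *v \<bar>r + transpose B *v p\<bar> \<le> transpose E *v \<zeta>"
    by (simp only: matrix_vector_mult_diff_distrib diff_ge_0_iff_ge)
  then have "s + transpose A *v p - transpose E *v \<zeta> \<le> bellman p"
    unfolding bellman_def by (rule diff_left_mono)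
  with assms show ?thesis
    unfolding lp_feasible_def by (blast intro: order_trans)
qed

text \<open>The chosen \<open>\<zeta>\<close> is the smallest one the two-sided constraint allows.
  With the preceding lemma, \<open>\<zeta>\<close> is eliminated: the program maximizes over
  \<open>p \<ge> 0\<close> with \<open>p \<le> bellman p\<close>.\<close>

lemma le_bellman_imp_lp_feasible:
  assumes "0 \<le> p" "p \<le> bellman p"
  shows "lp_feasible A B E s r p \<bar>r + transpose B *v p\<bar>"
  using assms unfolding lp_feasible_def bellman_def
  by (auto simp: less_eq_vec_def abs_vec_def minus_le_iff)

text \<open>By monotonicity \<open>bellman p\<close> is feasible again and dominates
  \<open>p\<close>; optimality bounds its entry sum by that of \<open>p\<close>, so no entry can
  have grown.\<close>

lemma lp_optimal_imp_fixed_point: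
  assumes "lp_optimal A B E s r p \<zeta>"
  shows "0 \<le> p" "bellman p = p"
proof -
  show p: "0 \<le> p"
    using assms by (simp add: lp_optimal_def lp_feasible_def)
  have le: "p \<le> bellman p"
    using assms lp_feasible_imp_le_bellman unfolding lp_optimal_def by blast
  have "lp_feasible A B E s r (bellman p) \<bar>r + transpose B *v bellman p\<bar>"
    using bellman_nonneg[OF p] bellman_mono[OF le] by (rule le_bellman_imp_lp_feasible)
  then have "1 \<bullet> bellman p \<le> 1 \<bullet> p"
    using assms unfolding lp_optimal_def by blast
  then have "(\<Sum>i\<in>UNIV. bellman p $ i - p $ i) \<le> 0"
    by (simp add: inner_vec_def sum_subtractf)
  moreover have nn: "0 \<le> bellman p $ i - p $ i" for i
    using le by (simp add: less_eq_vec_def)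
  ultimately have "(\<Sum>i\<in>UNIV. bellman p $ i - p $ i) = 0"
    by (meson order_antisym sum_nonneg)
  then have "\<forall>i\<in>UNIV. bellman p $ i - p $ i = 0"
    using nn by (subst (asm) sum_nonneg_eq_0_iff) auto
  then show "bellman p = p"
    by (simp add: vec_eq_iff)
qed

lemma fixed_point_imp_lp_optimal:
  assumes "0 \<le> p" "bellman p = p"
  shows "lp_optimal A B E s r p \<bar>r + transpose B *v p\<bar>"
  unfolding lp_optimal_def
proof safe
  show "lp_feasible A B E s r p \<bar>r + transpose B *v p\<bar>"
    using assms by (intro le_bellman_imp_lp_feasible) auto
  fix q \<zeta> assume "lp_feasible A B E s r q \<zeta>"
  then have "q \<le> p"
    using fixed_point_greatest[OF assms] lp_feasible_imp_le_bellman by blast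
  then show "1 \<bullet> q \<le> 1 \<bullet> p"
    using inner_mono_left[of q p 1] by (simp add: inner_commute less_eq_vec_def)
qed

section \<open>Lower bounds on the cost of an arbitrary policy\<close>

abbreviation cost :: "(real^'n \<Rightarrow> real^'m) \<Rightarrow> real^'n \<Rightarrow> (nat \<Rightarrow> real^'l) \<Rightarrow> nat \<Rightarrow> real"
  where "cost \<mu> x0 w t \<equiv>
    stage_cost s r \<gamma> (state A B F \<mu> x0 w t) (\<mu> (state A B F \<mu> x0 w t)) (w t)"

lemma state_Suc_nonneg:
  assumes "admissible E \<mu>" "0 \<le> x" "0 \<le> v"
  shows "0 \<le> A *v x + B *v \<mu> x + F *v v"
proof -
  have "\<bar>\<mu> x\<bar> \<le> E *v x"
    using assms by (simp add: admissible_def)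
  then show ?thesis
    by (intro add_nonneg_nonneg next_state_nonneg mult_vec_nonneg F_nonneg assms)
qed

lemma state_nonneg:
  assumes "admissible E \<mu>" "0 \<le> x0" "\<And>t. 0 \<le> w t"
  shows "0 \<le> state A B F \<mu> x0 w t"
  by (induction t) (use assms state_Suc_nonneg in auto)

text \<open>Finite-horizon dynamic programming. After the disturbance \<open>w t\<close> acts,
  \<open>T - Suc t\<close> steps remain, so it is priced by
  \<open>value_iter (T - Suc t)\<close>.\<close>

lemma cost_sum_ge:
  assumes "admissible E \<mu>" "0 \<le> x0" "\<And>t. 0 \<le> w t"
  shows "value_iter T \<bullet> x0 + (\<Sum>t<T. (transpose F *v value_iter (T - Suc t) - \<gamma>) \<bullet> w t)
    \<le> (\<Sum>t<T. cost \<mu> x0 w t)"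
  using assms(2,3)
proof (induction T arbitrary: x0 w)
  case (Suc T)
  define y where "y = A *v x0 + B *v \<mu> x0 + F *v w 0"
  have "0 \<le> y"
    unfolding y_def by (rule state_Suc_nonneg[OF assms(1) Suc.prems])
  then have IH: "value_iter T \<bullet> y
      + (\<Sum>t<T. (transpose F *v value_iter (T - Suc t) - \<gamma>) \<bullet> w (Suc t))
      \<le> (\<Sum>t<T. cost \<mu> y (\<lambda>t. w (Suc t)) t)"
    using Suc.prems by (intro Suc.IH) auto
  have "\<bar>\<mu> x0\<bar> \<le> E *v x0"
    using assms(1) Suc.prems(1) by (simp add: admissible_def)
  then have "value_iter (Suc T) \<bullet> x0
      \<le> s \<bullet> x0 + r \<bullet> \<mu> x0 + value_iter T \<bullet> (A *v x0 + B *v \<mu> x0)"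
    using bellman_le by simp
  moreover have "value_iter T \<bullet> y
      = value_iter T \<bullet> (A *v x0 + B *v \<mu> x0) + (transpose F *v value_iter T) \<bullet> w 0"
    unfolding y_def inner_transpose_mult by (simp add: inner_add_right)
  ultimately show ?case
    using IH unfolding sum.lessThan_Suc_shift state_shift y_def[symmetric]
    by (simp add: stage_cost_def inner_diff_left)
qed simp

text \<open>Without disturbance, \<open>cost_sum_ge\<close> and the growth of the iterates put every
  partial sum of length at least \<open>T\<close> above the bound.\<close>

lemma total_cost_ge_value_iter:
  assumes "admissible E \<mu>" "0 \<le> x0"
  shows "ereal (value_iter T \<bullet> x0) \<le> total_cost A B F s r \<gamma> \<mu> x0 (\<lambda>_. 0)"
  unfolding total_cost_def
proof (rule le_Limsup)
  show "\<forall>\<^sub>F T' in sequentially. ereal (value_iter T \<bullet> x0) \<le> ereal (\<Sum>t<T'. cost \<mu> x0 (\<lambda>_. 0) t)"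
    using eventually_ge_at_top[of T]
  proof eventually_elim
    case (elim T')
    then have "value_iter T \<bullet> x0 \<le> value_iter T' \<bullet> x0"
      by (intro inner_mono_left incseqD[OF incseq_value_iter] assms)
    also have "\<dots> \<le> (\<Sum>t<T'. cost \<mu> x0 (\<lambda>_. 0) t)"
      using cost_sum_ge[OF assms, of "\<lambda>_. 0" T'] by simp
    finally show ?case
      by simp
  qed
qed simp

lemma opt_value_ge_value_iter:
  assumes "0 \<le> x0"
  shows "ereal (value_iter T \<bullet> x0) \<le> opt_value A B F E s r \<gamma> x0"
  unfolding opt_value_def worst_case_cost_def
proof (rule INF_greatest)
  fix \<mu> assume "\<mu> \<in> {\<mu>. admissible E \<mu>}"
  then show "ereal (value_iter T \<bullet> x0)
      \<le> (SUP w\<in>{w. \<forall>t. 0 \<le> w t}. total_cost A B F s r \<gamma> \<mu> x0 w)"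
    using total_cost_ge_value_iter assms by (intro SUP_upper2[of "\<lambda>_. 0"]) auto
qed

text \<open>A disturbance acting only at time 0 leaves a single term of the sum in
  \<open>cost_sum_ge\<close>; then the horizon tends to infinity. Taking \<open>v = 0\<close> bounds
  the value below by \<open>p \<bullet> x0\<close>, and scaling \<open>v\<close> forces
  \<open>transpose F *v p \<le> \<gamma>\<close>.\<close>

lemma opt_value_ge_impulse:
  assumes "0 \<le> x0" "0 \<le> v" and lim: "value_iter \<longlonglongrightarrow> p"
  shows "ereal (p \<bullet> x0 + (transpose F *v p - \<gamma>) \<bullet> v) \<le> opt_value A B F E s r \<gamma> x0"
  unfolding opt_value_def worst_case_cost_def
proof (rule INF_greatest)
  fix \<mu> assume "\<mu> \<in> {\<mu>. admissible E \<mu>}"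
  then have \<mu>: "admissible E \<mu>"
    by simp
  define w where "w t = (if t = 0 then v else 0)" for t :: nat
  have w: "0 \<le> w t" "w 0 = v" "w (Suc t) = 0" for t
    using assms by (simp_all add: w_def)
  \<comment> \<open>Horizon \<open>Suc T\<close> leaves \<open>T\<close> steps after the impulse;
    the shift by one does not affect the limsup.\<close>
  have "value_iter (Suc T) \<bullet> x0 + (transpose F *v value_iter T - \<gamma>) \<bullet> v
      \<le> (\<Sum>t<Suc T. cost \<mu> x0 w t)" for T
    using cost_sum_ge[OF \<mu> assms(1), of w "Suc T"] w(1)
    by (simp add: sum.lessThan_Suc_shift[of "\<lambda>t. _ t \<bullet> w t"] w(2,3) del: sum.lessThan_Suc)
  moreover have "(\<lambda>T. ereal (value_iter (Suc T) \<bullet> x0 + (transpose F *v value_iter T - \<gamma>) \<bullet> v))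
      \<longlonglongrightarrow> ereal (p \<bullet> x0 + (transpose F *v p - \<gamma>) \<bullet> v)"
    by (intro tendsto_intros lim LIMSEQ_Suc[OF lim])
  then have "limsup (\<lambda>T. ereal (value_iter (Suc T) \<bullet> x0 + (transpose F *v value_iter T - \<gamma>) \<bullet> v))
      = ereal (p \<bullet> x0 + (transpose F *v p - \<gamma>) \<bullet> v)"
    by (intro lim_imp_Limsup) simp
  ultimately have "ereal (p \<bullet> x0 + (transpose F *v p - \<gamma>) \<bullet> v)
      \<le> limsup (\<lambda>T. ereal (\<Sum>t<Suc T. cost \<mu> x0 w t))"
    by (metis (mono_tags, lifting) Limsup_mono always_eventually ereal_less_eq(3))
  also have "\<dots> = total_cost A B F s r \<gamma> \<mu> x0 w"
    unfolding total_cost_def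
    using limsup_shift[of "\<lambda>T. ereal (\<Sum>t<T. cost \<mu> x0 w t)"] by (simp del: sum.lessThan_Suc)
  finally show "ereal (p \<bullet> x0 + (transpose F *v p - \<gamma>) \<bullet> v)
      \<le> (SUP w\<in>{w. \<forall>t. 0 \<le> w t}. total_cost A B F s r \<gamma> \<mu> x0 w)"
    using w(1) by (intro SUP_upper2[of w]) auto
qed

section \<open>Optimality of the feedback law and the finiteness criterion\<close>

lemma fixed_point_policy_le:
  assumes p: "0 \<le> p" "bellman p = p" and Fp: "transpose F *v p \<le> \<gamma>" and x0: "0 \<le> x0"
  shows "worst_case_cost A B F s r \<gamma> (\<lambda>x. - (gain B E r p *v x)) x0 \<le> ereal (p \<bullet> x0)"
  unfolding worst_case_cost_def
proof (rule SUP_least)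
  fix w :: "nat \<Rightarrow> real^'l" assume "w \<in> {w. \<forall>t. 0 \<le> w t}"
  then have w: "\<And>t. 0 \<le> w t"
    by simp
  let ?\<mu> = "\<lambda>x. - (gain B E r p *v x)"
  let ?x = "state A B F ?\<mu> x0 w"
  have x: "0 \<le> ?x t" for t
    using gain_admissible x0 w by (intro state_nonneg) (auto simp: admissible_def)
  have step: "cost ?\<mu> x0 w t + p \<bullet> ?x (Suc t) \<le> p \<bullet> ?x t" for t
  proof -
    have "p \<bullet> ?x t = s \<bullet> ?x t + r \<bullet> ?\<mu> (?x t) + p \<bullet> (A *v ?x t + B *v ?\<mu> (?x t))"
      using bellman_eq[OF refl, of p "?x t"] p(2) by simp
    moreover have "p \<bullet> (F *v w t) \<le> \<gamma> \<bullet> w t"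
      using inner_mono_left[OF Fp w[of t]] by (simp only: inner_transpose_mult)
    ultimately show ?thesis
      by (simp add: stage_cost_def inner_add_right)
  qed
  have "(\<Sum>t<T. cost ?\<mu> x0 w t) + p \<bullet> ?x T \<le> p \<bullet> x0" for T
  proof (induction T)
    case (Suc T)
    then show ?case
      using step[of T] by (simp del: state.simps)
  qed simp
  moreover have "0 \<le> p \<bullet> ?x T" for T
    using inner_mono_left[OF p(1) x[of T]] by simp
  ultimately have "(\<Sum>t<T. cost ?\<mu> x0 w t) \<le> p \<bullet> x0" for T
    by (meson add_increasing2 order_refl order_trans)
  then show "total_cost A B F s r \<gamma> ?\<mu> x0 w \<le> ereal (p \<bullet> x0)"
    unfolding total_cost_def by (intro Limsup_bounded always_eventually) simp
qed

lemma fixed_point_value: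
  assumes p: "0 \<le> p" "bellman p = p" and Fp: "transpose F *v p \<le> \<gamma>"
  shows "0 \<le> x0 \<Longrightarrow> opt_value A B F E s r \<gamma> x0 = ereal (p \<bullet> x0)"
    and "optimal_policy A B F E s r \<gamma> (\<lambda>x. - (gain B E r p *v x))"
proof -
  let ?\<mu> = "\<lambda>x. - (gain B E r p *v x)"
  have adm: "admissible E ?\<mu>"
    using gain_admissible by (simp add: admissible_def)
  have le: "opt_value A B F E s r \<gamma> x0 \<le> worst_case_cost A B F s r \<gamma> ?\<mu> x0" for x0
    unfolding opt_value_def using adm by (intro INF_lower) simp
  \<comment> \<open>\<open>order_refl\<close> selects the zero impulse.\<close>
  have ge: "ereal (p \<bullet> x0) \<le> opt_value A B F E s r \<gamma> x0" if "0 \<le> x0" for x0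
    using opt_value_ge_impulse[OF that order_refl value_iter_tendsto_fixed_point[OF p]] by simp
  show val: "opt_value A B F E s r \<gamma> x0 = ereal (p \<bullet> x0)" if "0 \<le> x0" for x0
    using order_trans[OF le fixed_point_policy_le[OF assms that]] ge[OF that] by (rule order_antisym)
  show "optimal_policy A B F E s r \<gamma> ?\<mu>"
    unfolding optimal_policy_def
    using adm le val fixed_point_policy_le[OF assms] by (metis order_antisym)
qed

lemma finite_value_imp_fixed_point:
  assumes fin: "\<And>x0. 0 \<le> x0 \<Longrightarrow> \<bar>opt_value A B F E s r \<gamma> x0\<bar> \<noteq> \<infinity>"
  obtains p where "0 \<le> p" "bellman p = p" "transpose F *v p \<le> \<gamma>"
proof -
  have one: "0 \<le> (1::real^'n)"
    by (simp add: less_eq_vec_def)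
  obtain c where c: "opt_value A B F E s r \<gamma> 1 = ereal c"
    using fin[OF one] by auto
  have "1 \<bullet> value_iter T \<le> c" for T
    using opt_value_ge_value_iter[OF one, of T] by (simp add: c inner_commute)
  then obtain p where p: "value_iter \<longlonglongrightarrow> p" "0 \<le> p" "bellman p = p"
    using bounded_value_iter_tendsto by blast
  \<comment> \<open>At the origin \<open>p \<bullet> x0\<close> vanishes, so \<open>d\<close> bounds
    every nonnegative multiple of the impulse gain \<open>e\<close>.\<close>
  obtain d where d: "opt_value A B F E s r \<gamma> 0 = ereal d"
    using fin[of 0] by auto
  have "transpose F *v p \<le> \<gamma>"
  proof (rule vec_le_if_inner_le)
    fix v :: "real^'l" assume v: "0 \<le> v"
    define e where "e = (transpose F *v p - \<gamma>) \<bullet> v"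
    have bnd: "k * e \<le> d" if "0 \<le> k" for k :: real
    proof -
      have "0 \<le> k *\<^sub>R v"
        using v that by (simp add: less_eq_vec_def)
      from opt_value_ge_impulse[OF order_refl this p(1)] show ?thesis
        by (simp add: d e_def del: transpose_matrix_vector)
    qed
    have "e \<le> 0"
    proof (rule ccontr)
      assume "\<not> e \<le> 0"
      \<comment> \<open>This multiple would give \<open>\<bar>d\<bar> + 1 \<le> d\<close>.\<close>
      with bnd[of "(\<bar>d\<bar> + 1) / e"] show False
        by simp
    qed
    then show "(transpose F *v p) \<bullet> v \<le> \<gamma> \<bullet> v"
      by (simp add: e_def inner_diff_left)
  qed
  with p that show thesis
    by blast
qed

end

theorem theorem1:
  fixes A :: "real^'n^'n" and B :: "real^'m^'n" and F :: "real^'l^'n" and E :: "real^'n^'m"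
    and s :: "real^'n" and r :: "real^'m" and \<gamma> :: "real^'l"
  assumes "0 \<le> F" and "0 \<le> E" and "vec_less 0 s" and "0 \<le> \<gamma>"
    and "\<bar>B\<bar> ** E \<le> A"
    and "vec_less (transpose E *v \<bar>r\<bar>) s"
  shows "((\<forall>x0\<ge>0. \<bar>opt_value A B F E s r \<gamma> x0\<bar> \<noteq> \<infinity>) \<longleftrightarrow>
           (\<exists>p \<zeta>. lp_optimal A B E s r p \<zeta> \<and> transpose F *v p \<le> \<gamma>)) \<and>
         ((\<exists>p \<zeta>. lp_optimal A B E s r p \<zeta> \<and> transpose F *v p \<le> \<gamma>) \<longrightarrow>
           (\<forall>p \<zeta>. lp_optimal A B E s r p \<zeta> \<longrightarrow>
             (\<forall>x0\<ge>0. opt_value A B F E s r \<gamma> x0 = ereal (p \<bullet> x0)) \<and>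
             p \<le> s + transpose A *v p - transpose E *v \<bar>r + transpose B *v p\<bar> \<and>
             optimal_policy A B F E s r \<gamma> (\<lambda>x. - (gain B E r p *v x))))"
proof -
  interpret positive_control A B F E s r \<gamma>
    using assms by unfold_locales
  have exists_iff: "(\<exists>p \<zeta>. lp_optimal A B E s r p \<zeta> \<and> transpose F *v p \<le> \<gamma>) \<longleftrightarrow>
      (\<exists>p\<ge>0. bellman p = p \<and> transpose F *v p \<le> \<gamma>)"
    using lp_optimal_imp_fixed_point fixed_point_imp_lp_optimal by blast
  have "(\<forall>x0\<ge>0. \<bar>opt_value A B F E s r \<gamma> x0\<bar> \<noteq> \<infinity>) \<longleftrightarrow>
      (\<exists>p\<ge>0. bellman p = p \<and> transpose F *v p \<le> \<gamma>)"
  proof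
    assume "\<forall>x0\<ge>0. \<bar>opt_value A B F E s r \<gamma> x0\<bar> \<noteq> \<infinity>"
    then show "\<exists>p\<ge>0. bellman p = p \<and> transpose F *v p \<le> \<gamma>"
      using finite_value_imp_fixed_point by metis
  next
    assume "\<exists>p\<ge>0. bellman p = p \<and> transpose F *v p \<le> \<gamma>"
    then show "\<forall>x0\<ge>0. \<bar>opt_value A B F E s r \<gamma> x0\<bar> \<noteq> \<infinity>"
      using fixed_point_value(1) by force
  qed
  moreover have "(\<forall>x0\<ge>0. opt_value A B F E s r \<gamma> x0 = ereal (p \<bullet> x0)) \<and>
      p \<le> s + transpose A *v p - transpose E *v \<bar>r + transpose B *v p\<bar> \<and>
      optimal_policy A B F E s r \<gamma> (\<lambda>x. - (gain B E r p *v x))"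
    if q: "0 \<le> q" "bellman q = q" "transpose F *v q \<le> \<gamma>" and opt: "lp_optimal A B E s r p \<zeta>"
    for p q \<zeta>
  proof -
    note p = lp_optimal_imp_fixed_point[OF opt]
    \<comment> \<open>Uniqueness of the fixed point transfers the bound by \<open>\<gamma>\<close>
      from the given \<open>q\<close> to every optimal solution \<open>p\<close>.\<close>
    have "p = q"
      using fixed_point_greatest[OF p, of q] fixed_point_greatest[OF q(1,2), of p] p q by auto
    with q(3) have "transpose F *v p \<le> \<gamma>"
      by simp
    then show ?thesis
      using fixed_point_value[OF p] p(2) unfolding bellman_def by simp
  qed
  ultimately show ?thesis
    unfolding exists_iff by blast
qed

end
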